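(* For every $p\in(0,1/2)$, $$\lim_{n\to\infty}(\alpha_n,\beta_n,\gamma_n)=\left(\tfrac25,\tfrac25,\tfrac15\right)\qquad\text{and}\qquad \lim_{n\to\infty}(a_n,b_n,c_n)=(1,0,0).$$
   Context: Let $\Sigma=\{1,2,3\}$, $\Sigma^0=\{\vartheta\}$ with $\vartheta$ the empty word, $\Sigma^n=\{1,2,3\}^n$ and $\Sigma^*=\bigcup_{n\ge 0}\Sigma^n$. For $a\in\Sigma$, $a^n$ is the word consisting of $n$ letters $a$. For $n\ge1$ put $V^n=\{1^n,2^n,3^n\}$ and $\tilde\Sigma^n=\Sigma^n\setminus V^n$. Fix $p\in(0,1/2)$ and $q=1-2p$. Every $u\in\tilde\Sigma^n$ is uniquely of the form $u=\omega i j^{n-k}$ with $1\le k\le n-1$, $\omega\in\Sigma^{k-1}$ and $i\ne j$ in $\Sigma$; let $l$ be the third letter. The Markov chain $(X_m)_{m\ge0}$ with origin $\vartheta$ and state space $\Sigma^*$ has transition probabilities: $P(\vartheta,i)=1/3$ for $i\in\Sigma$; for $u=\omega i j^{n-k}\in\tilde\Sigma^n$ with $1\le k\le n-1$, $\omega\in\Sigma^{k-1}$, $i\ne j$ in $\Sigma$ and $l$ the element of $\Sigma\setminus\{i,j\}$, $P(u,\omega j i^{n-k})=p$, $P(u,\omega i j^{n-k-1}i)=p$, $P(u,\omega i j^{n-k-1}l)=q$; for $u\in V^n$ ($n\ge1$), $P(u,ui)=1/3$ for $i\in\Sigma$; all other transition probabilities are $0$. For $x,y\in\Sigma^*$ let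 $\rho_{x,y}=\mathbb P(\exists k\ge 0: X_k=y\mid X_0=x)$, and for $x\in\Sigma^n$, $i\in\Sigma$ let $\rho_i(x)=\rho_{x,i^n}$. For $n\ge2$ define $\alpha_n=\rho_1(12^{n-1})$, $\beta_n=\rho_2(12^{n-1})$, $\gamma_n=\rho_3(12^{n-1})$ and $a_n=\rho_1(1^{n-1}2)$, $b_n=\rho_2(1^{n-1}2)$, $c_n=\rho_3(1^{n-1}2)$. *)

theory Defs
  imports "HOL-Probability.Probability"
begin

datatype letter = L1 | L2 | L3

lemma UNIV_letter: "UNIV = {L1, L2, L3}"
  using letter.exhaust by auto

instance letter :: finite
  by standard (simp add: UNIV_letter)

text \<open>
  Transition probabilities of the chain on words. The words in which all letters are equal are
  the \<open>replicate n i\<close>; \<open>n = 0\<close> is the empty word, at which the chain appends a uniformly chosen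
  letter just as it does at the words \<open>i\<^sup>n\<close> with \<open>n \<ge> 1\<close>. Any other word \<open>u\<close> is uniquely of the
  form \<open>w i j\<^sup>m\<^sup>+\<^sup>1\<close> with \<open>i \<noteq> j\<close> (see \<open>split_exists\<close> and \<open>split_unique\<close>); in terms of the length
  \<open>n\<close> of \<open>u\<close> and the position \<open>k\<close> of \<open>i\<close>, the number \<open>m\<close> is \<open>n - k - 1\<close>.
\<close>

definition trans_prob :: "real \<Rightarrow> letter list \<Rightarrow> letter list \<Rightarrow> real" where
  "trans_prob p u v =
    (if \<exists>n i. u = replicate n i then
       (if \<exists>i. v = u @ [i] then 1/3 else 0)
     else if \<exists>w i j m. i \<noteq> j \<and> u = w @ [i] @ replicate (Suc m) j \<and>
         (v = w @ [j] @ replicate (Suc m) i \<or> v = w @ [i] @ replicate m j @ [i]) then p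
     else if \<exists>w i j l m. distinct [i, j, l] \<and> u = w @ [i] @ replicate (Suc m) j \<and>
         v = w @ [i] @ replicate m j @ [l] then 1 - 2 * p
     else 0)"

text \<open>For \<open>0 < p < 1/2\<close> this is the probability mass function \<open>trans_prob p u\<close>; see \<open>pmf_step\<close>.\<close>

definition step_pmf :: "real \<Rightarrow> letter list \<Rightarrow> letter list pmf" where
  "step_pmf p u = embed_pmf (trans_prob p u)"

text \<open>
  The law of the whole trajectory \<open>\<omega> = (X\<^sub>0, X\<^sub>1, \<dots>)\<close> of the chain started at \<open>x\<close>, obtained by
  the Ionescu-Tulcea construction from the conditional law \<open>step_kernel\<close> of \<open>X\<^sub>n\<close> given
  \<open>X\<^sub>0, \<dots>, X\<^sub>n\<^sub>-\<^sub>1\<close>. It is characterised by its finite-dimensional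
  distributions in \<open>chain_measure_cylinder\<close>.
\<close>

definition step_kernel ::
    "real \<Rightarrow> letter list \<Rightarrow> nat \<Rightarrow> (nat \<Rightarrow> letter list) \<Rightarrow> letter list measure" where
  "step_kernel p x n \<omega> =
     measure_pmf (case n of 0 \<Rightarrow> return_pmf x | Suc m \<Rightarrow> step_pmf p (\<omega> m))"

definition chain_measure :: "real \<Rightarrow> letter list \<Rightarrow> (nat \<Rightarrow> letter list) measure" where
  "chain_measure p x =
     projective_family.lim UNIV
       (Ionescu_Tulcea.CI (step_kernel p x) (\<lambda>_. count_space UNIV)) (\<lambda>_. count_space UNIV)"

definition rho :: "real \<Rightarrow> letter list \<Rightarrow> letter list \<Rightarrow> real" where
  "rho p x y = \<P>(\<omega> in chain_measure p x. \<exists>k. \<omega> k = y)"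

definition rho_letter :: "real \<Rightarrow> letter \<Rightarrow> letter list \<Rightarrow> real" where
  "rho_letter p i x = rho p x (replicate (length x) i)"

text \<open>The following six sequences are meant for \<open>n \<ge> 2\<close> only.\<close>

definition alpha_seq :: "real \<Rightarrow> nat \<Rightarrow> real" where
  "alpha_seq p n = rho_letter p L1 ([L1] @ replicate (n - 1) L2)"

definition beta_seq :: "real \<Rightarrow> nat \<Rightarrow> real" where
  "beta_seq p n = rho_letter p L2 ([L1] @ replicate (n - 1) L2)"

definition gamma_seq :: "real \<Rightarrow> nat \<Rightarrow> real" where
  "gamma_seq p n = rho_letter p L3 ([L1] @ replicate (n - 1) L2)"

definition a_seq :: "real \<Rightarrow> nat \<Rightarrow> real" where
  "a_seq p n = rho_letter p L1 (replicate (n - 1) L1 @ [L2])"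

definition b_seq :: "real \<Rightarrow> nat \<Rightarrow> real" where
  "b_seq p n = rho_letter p L2 (replicate (n - 1) L1 @ [L2])"

definition c_seq :: "real \<Rightarrow> nat \<Rightarrow> real" where
  "c_seq p n = rho_letter p L3 (replicate (n - 1) L1 @ [L2])"

text \<open>The definitions above do describe a Markov chain with the stated transition probabilities.\<close>

lemma split_exists:
  assumes "\<not> (\<exists>n i. u = replicate n i)"
  shows "\<exists>w i j m. i \<noteq> j \<and> u = w @ [i] @ replicate (Suc m) j"
  using assms
proof (induction u)
  case Nil
  then show ?case by (metis replicate_0)
next
  case (Cons a u)
  show ?case
  proof (cases "\<exists>n i. u = replicate n i")
    case True
    then obtain n i where u: "u = replicate n i" by blast
    have "n \<noteq> 0" using Cons.prems u by (metis replicate_0 replicate_Suc)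
    then obtain m where n: "n = Suc m" using not0_implies_Suc by blast
    have "a \<noteq> i" using Cons.prems u by (metis replicate_Suc)
    then show ?thesis using u n by (intro exI[of _ "[]"]) auto
  next
    case False
    with Cons.IH obtain w i j m where "i \<noteq> j" "u = w @ [i] @ replicate (Suc m) j" by blast
    then show ?thesis by (intro exI[of _ "a # w"]) auto
  qed
qed

lemma split_unique:
  assumes eq: "w @ [i] @ replicate (Suc m) j = w' @ [i'] @ replicate (Suc m') j'"
    and ne: "i \<noteq> j" "i' \<noteq> j'"
  shows "w = w' \<and> i = i' \<and> j = j' \<and> m = m'"
proof -
  have r: "replicate (Suc m) j @ [i] @ rev w = replicate (Suc m') j' @ [i'] @ rev w'"
    using arg_cong[OF eq, of rev] unfolding rev_append rev_replicate rev.simps append.simps append_assoc .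
  then have j: "j = j'"
    unfolding replicate_Suc append_Cons list.inject by blast
  have tw: "takeWhile (\<lambda>x. x = k) (replicate n k @ [l] @ v) = replicate n k" if "l \<noteq> k"
    for k l :: 'a and n v using that by (induction n) auto
  have "replicate (Suc m) j = replicate (Suc m') j"
    using arg_cong[OF r, of "takeWhile (\<lambda>x. x = j)"] tw ne j by metis
  then have "m = m'" by (metis length_replicate nat.inject)
  then show ?thesis using r j by simp
qed

lemma split_nonconst:
  assumes "i \<noteq> j"
  shows "w @ [i] @ replicate (Suc m) j \<noteq> replicate n k"
proof
  assume "w @ [i] @ replicate (Suc m) j = replicate n k"
  then have "set (w @ [i] @ replicate (Suc m) j) \<subseteq> {k}" using set_replicate_conv_if[of n k] by (auto split: if_splits)
  with assms show False by auto
qed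

lemma third_letter:
  fixes i j :: letter
  assumes "i \<noteq> j"
  shows "\<exists>l. distinct [i, j, l]"
proof -
  have "UNIV \<noteq> {i, j}" using assms by (cases i; cases j; auto simp: UNIV_letter)
  then show ?thesis using assms by auto
qed

lemma third_letter_unique: "distinct [i :: letter, j, l] \<Longrightarrow> distinct [i, j, l'] \<Longrightarrow> l = l'"
  by (cases i; cases j; cases l; cases l'; simp)

lemma trans_prob_const:
  "trans_prob p (replicate n i) v = (if \<exists>k. v = replicate n i @ [k] then 1/3 else 0)"
proof -
  have "\<exists>m j. replicate n i = replicate m j" by blast
  then show ?thesis unfolding trans_prob_def by (rule if_P)
qed

lemma trans_prob_split:
  assumes d: "distinct [i, j, l]"
  shows "trans_prob p (w @ [i] @ replicate (Suc m) j) v =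
    (if v = w @ [j] @ replicate (Suc m) i \<or> v = w @ [i] @ replicate m j @ [i] then p
     else if v = w @ [i] @ replicate m j @ [l] then 1 - 2 * p else 0)"
proof -
  let ?u = "w @ [i] @ replicate (Suc m) j"
  have ne: "i \<noteq> j" using d by auto
  have 1: "\<not> (\<exists>n k. ?u = replicate n k)" using split_nonconst[OF ne] by blast
  have 2: "(\<exists>w' i' j' m'. i' \<noteq> j' \<and> ?u = w' @ [i'] @ replicate (Suc m') j' \<and>
      (v = w' @ [j'] @ replicate (Suc m') i' \<or> v = w' @ [i'] @ replicate m' j' @ [i'])) \<longleftrightarrow>
      v = w @ [j] @ replicate (Suc m) i \<or> v = w @ [i] @ replicate m j @ [i]" (is "?L = ?R")
  proof
    assume ?L
    then obtain w' i' j' m' where "i' \<noteq> j'" and e: "?u = w' @ [i'] @ replicate (Suc m') j'"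
      and v: "v = w' @ [j'] @ replicate (Suc m') i' \<or> v = w' @ [i'] @ replicate m' j' @ [i']"
      by blast
    from split_unique[OF e ne \<open>i' \<noteq> j'\<close>] v show ?R by blast
  next
    assume ?R then show ?L using ne by blast
  qed
  have 3: "(\<exists>w' i' j' l' m'. distinct [i', j', l'] \<and> ?u = w' @ [i'] @ replicate (Suc m') j' \<and>
      v = w' @ [i'] @ replicate m' j' @ [l']) \<longleftrightarrow> v = w @ [i] @ replicate m j @ [l]" (is "?L = ?R")
  proof
    assume ?L
    then obtain w' i' j' l' m' where d': "distinct [i', j', l']"
      and e: "?u = w' @ [i'] @ replicate (Suc m') j'" and v: "v = w' @ [i'] @ replicate m' j' @ [l']"
      by blast
    from d' have "i' \<noteq> j'" by auto
    from split_unique[OF e ne this] v d' third_letter_unique[OF d] show ?R by blast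
  next
    assume ?R then show ?L using d by blast
  qed
  show ?thesis unfolding trans_prob_def 2 3 using 1 by simp
qed

lemma trans_prob_stochastic:
  assumes p: "0 < p" "p < 1/2"
  shows "trans_prob p u v \<ge> 0" and "(\<integral>\<^sup>+v. ennreal (trans_prob p u v) \<partial>count_space UNIV) = 1"
proof -
  show nonneg: "trans_prob p u v \<ge> 0" for v
    unfolding trans_prob_def using p by simp
  have *: "\<exists>A. finite A \<and> (\<forall>v. v \<notin> A \<longrightarrow> trans_prob p u v = 0) \<and> (\<Sum>v\<in>A. trans_prob p u v) = 1"
  proof (cases "\<exists>n i. u = replicate n i")
    case True
    then obtain n i where u: "u = replicate n i" by blast
    let ?A = "{u @ [L1], u @ [L2], u @ [L3]}"
    have "trans_prob p u v = 0" if "v \<notin> ?A" for v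
    proof -
      have "v \<noteq> u @ [k]" for k using that by (cases k) auto
      then show ?thesis unfolding u trans_prob_const by simp
    qed
    moreover have "(\<Sum>v\<in>?A. trans_prob p u v) = 1"
      unfolding u trans_prob_const by simp
    ultimately show ?thesis by (intro exI[of _ ?A]) auto
  next
    case False
    then obtain w i j m where ne: "i \<noteq> j" and u: "u = w @ [i] @ replicate (Suc m) j"
      using split_exists by blast
    obtain l where d: "distinct [i, j, l]" using third_letter[OF ne] by blast
    let ?x = "w @ [j] @ replicate (Suc m) i"
    let ?y = "w @ [i] @ replicate m j @ [i]"
    let ?z = "w @ [i] @ replicate m j @ [l]"
    have n: "?x \<noteq> ?y" "?x \<noteq> ?z" "?y \<noteq> ?z" using d by auto
    note t = trans_prob_split[OF d, of p w m]
    have v: "trans_prob p u ?x = p" "trans_prob p u ?y = p" "trans_prob p u ?z = 1 - 2 * p"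
      unfolding u t using n by presburger+
    have "trans_prob p u v = 0" if "v \<notin> {?x, ?y, ?z}" for v
      using that unfolding u t by simp
    moreover have "(\<Sum>v\<in>{?x, ?y, ?z}. trans_prob p u v) = 1"
    proof -
      have "(\<Sum>v\<in>{?x, ?y, ?z}. trans_prob p u v) =
          trans_prob p u ?x + (trans_prob p u ?y + trans_prob p u ?z)"
        using n by (subst sum.insert, simp, blast, subst sum.insert, simp, blast, simp)
      then show ?thesis unfolding v by simp
    qed
    ultimately show ?thesis by (intro exI[of _ "{?x, ?y, ?z}"]) auto
  qed
  then obtain A where A: "finite A" "\<And>v. v \<notin> A \<Longrightarrow> trans_prob p u v = 0"
    "(\<Sum>v\<in>A. trans_prob p u v) = 1" by blast
  have "(\<integral>\<^sup>+v. ennreal (trans_prob p u v) \<partial>count_space UNIV) = (\<Sum>v\<in>A. ennreal (trans_prob p u v))"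
    using A(1,2) by (intro nn_integral_count_space') auto
  also have "\<dots> = ennreal (\<Sum>v\<in>A. trans_prob p u v)"
    using nonneg by (intro sum_ennreal) auto
  finally show "(\<integral>\<^sup>+v. ennreal (trans_prob p u v) \<partial>count_space UNIV) = 1"
    using A(3) by simp
qed

lemma pmf_step: "0 < p \<Longrightarrow> p < 1/2 \<Longrightarrow> pmf (step_pmf p u) v = trans_prob p u v"
  unfolding step_pmf_def by (rule pmf_embed_pmf) (auto intro: trans_prob_stochastic)

lemma Ionescu_Tulcea_step_kernel: "Ionescu_Tulcea (step_kernel p x) (\<lambda>_. count_space UNIV)"
proof (rule Ionescu_Tulcea.intro)
  show "step_kernel p x i \<in>
      measurable (PiM {0..<i} (\<lambda>_. count_space UNIV)) (subprob_algebra (count_space UNIV))" for i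
  proof (cases i)
    case 0
    then show ?thesis
      by (auto simp: step_kernel_def[abs_def] space_subprob_algebra
          intro!: measurable_const measure_pmf.subprob_space_axioms)
  next
    case (Suc m)
    have "(\<lambda>\<omega>. \<omega> m) \<in> measurable (PiM {0..<i} (\<lambda>_. count_space UNIV)) (count_space UNIV)"
      using Suc by (intro measurable_component_singleton) auto
    moreover have "(\<lambda>u. measure_pmf (step_pmf p u)) \<in>
        measurable (count_space UNIV) (subprob_algebra (count_space UNIV))"
      by (auto simp: space_subprob_algebra measure_pmf.subprob_space_axioms)
    ultimately have "(\<lambda>\<omega>. measure_pmf (step_pmf p (\<omega> m))) \<in>
        measurable (PiM {0..<i} (\<lambda>_. count_space UNIV)) (subprob_algebra (count_space UNIV))"
      by (rule measurable_compose)
    then show ?thesis by (simp add: step_kernel_def[abs_def] Suc)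
  qed
  show "prob_space (step_kernel p x i \<omega>)"
    if "\<omega> \<in> space (PiM {0..<i} (\<lambda>_. count_space UNIV))" for i \<omega>
    by (simp add: step_kernel_def prob_space_measure_pmf)
qed

lemma prob_space_chain_measure: "prob_space (chain_measure p x)"
proof -
  interpret IT: Ionescu_Tulcea "step_kernel p x" "\<lambda>_. count_space UNIV"
    by (rule Ionescu_Tulcea_step_kernel)
  have "emeasure IT.PF.lim (IT.PF.emb UNIV {} {\<lambda>_. undefined}) = emeasure (IT.CI {}) {\<lambda>_. undefined}"
    by (intro IT.lim) (auto simp: sets_PiM_empty)
  also have "\<dots> = 1"
  proof -
    have "prob_space (IT.CI {})" by (rule IT.PF.prob_space_P) auto
    moreover have "space (IT.CI {}) = {\<lambda>_. undefined}"
      by (simp add: IT.CI_def space_PiM)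
    ultimately show ?thesis using prob_space.emeasure_space_1 by metis
  qed
  also have "IT.PF.emb UNIV {} {\<lambda>_. undefined} = space IT.PF.lim"
    by (auto simp: prod_emb_def space_PiM)
  finally show ?thesis unfolding chain_measure_def by (rule prob_spaceI)
qed

lemma space_chain_measure [simp]: "space (chain_measure p x) = UNIV"
  and sets_chain_measure [measurable_cong, simp]:
    "sets (chain_measure p x) = sets (PiM UNIV (\<lambda>_. count_space UNIV))"
proof -
  interpret IT: Ionescu_Tulcea "step_kernel p x" "\<lambda>_. count_space UNIV"
    by (rule Ionescu_Tulcea_step_kernel)
  show s: "sets (chain_measure p x) = sets (PiM UNIV (\<lambda>_. count_space UNIV))"
    unfolding chain_measure_def by simp
  show "space (chain_measure p x) = UNIV"
    using sets_eq_imp_space_eq[OF s] by (simp add: space_PiM)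
qed

theorem chain_measure_cylinder:
  assumes p: "0 < p" "p < 1/2"
  shows "\<P>(\<omega> in chain_measure p x. \<forall>i\<le>n. \<omega> i = xs i) =
    (if xs 0 = x then \<Prod>i<n. trans_prob p (xs i) (xs (Suc i)) else 0)"
proof -
  interpret IT: Ionescu_Tulcea "step_kernel p x" "\<lambda>_. count_space UNIV"
    by (rule Ionescu_Tulcea_step_kernel)
  define A where "A n = PiE {0..<n} (\<lambda>i. {xs i})" for n :: nat
  have A_sets [measurable]: "A n \<in> sets (PiM {0..<n} (\<lambda>_. count_space UNIV))" for n
    unfolding A_def by (intro sets_PiM_I_finite) auto
  define K where "K n = (case n of 0 \<Rightarrow> (if xs 0 = x then 1 else 0)
      | Suc m \<Rightarrow> trans_prob p (xs m) (xs (Suc m)))" for n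
  have K_nonneg: "K n \<ge> 0" for n
    using trans_prob_stochastic(1)[OF p] by (auto simp: K_def split: nat.split)
  have C: "emeasure (IT.C 0 n (\<lambda>_. undefined)) (A n) = ennreal (\<Prod>i<n. K i)" for n
  proof (induction n)
    case 0
    show ?case by (simp add: A_def sets_PiM_empty)
  next
    case (Suc n)
    have eP: "emeasure (IT.eP n \<omega>) (A (Suc n)) = ennreal (K n) * indicator (A n) \<omega>"
      if \<omega>: "\<omega> \<in> space (PiM {0..<n} (\<lambda>_. count_space UNIV))" for \<omega>
    proof -
      have "(\<lambda>v. fun_upd \<omega> n v) -` A (Suc n) \<inter> UNIV = (if \<omega> \<in> A n then {xs n} else {})"
        using \<omega> unfolding A_def
        by (auto simp: space_PiM PiE_iff extensional_def less_Suc_eq split: if_splits)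
      then have "emeasure (IT.eP n \<omega>) (A (Suc n)) =
          emeasure (step_kernel p x n \<omega>) (if \<omega> \<in> A n then {xs n} else {})"
        using IT.emeasure_eP[OF \<omega> A_sets] by simp
      also have "\<dots> = ennreal (K n) * indicator (A n) \<omega>"
      proof (cases "\<omega> \<in> A n")
        case True
        then have "\<omega> i = xs i" if "i < n" for i using that by (auto simp: A_def PiE_iff)
        with True show ?thesis
          by (auto simp: step_kernel_def K_def emeasure_pmf_single pmf_step[OF p] split: nat.split)
      qed simp
      finally show ?thesis .
    qed
    have u: "(\<lambda>_. undefined) \<in> space (PiM {0..<0::nat} (\<lambda>_. count_space (UNIV :: letter list set)))"
      by (simp add: space_PiM)
    have "emeasure (IT.C 0 (Suc n) (\<lambda>_. undefined)) (A (Suc n)) =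
        (\<integral>\<^sup>+\<omega>. emeasure (IT.eP n \<omega>) (A (Suc n)) \<partial>IT.C 0 n (\<lambda>_. undefined))"
      unfolding IT.C.simps add_0
    proof (rule emeasure_bind)
      show "space (IT.C 0 n (\<lambda>_. undefined)) \<noteq> {}"
        using IT.space_C[OF u, of n] by simp
      show "IT.eP n \<in> measurable (IT.C 0 n (\<lambda>_. undefined))
          (subprob_algebra (PiM {0..<Suc n} (\<lambda>_. count_space UNIV)))"
        using IT.measurable_eP[of n] IT.sets_C[OF u, of n] by (simp cong: measurable_cong_sets)
    qed (rule A_sets)
    also have "\<dots> = (\<integral>\<^sup>+\<omega>. ennreal (K n) * indicator (A n) \<omega> \<partial>IT.C 0 n (\<lambda>_. undefined))"
      using IT.space_C[OF u, of n] by (intro nn_integral_cong eP) simp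
    also have "\<dots> = ennreal (K n) * emeasure (IT.C 0 n (\<lambda>_. undefined)) (A n)"
      using IT.sets_C[OF u, of n] A_sets[of n] by (intro nn_integral_cmult_indicator) simp
    also have "\<dots> = ennreal (\<Prod>i<Suc n. K i)"
      unfolding Suc.IH prod.lessThan_Suc using K_nonneg
      by (subst mult.commute, subst ennreal_mult) (auto intro: prod_nonneg)
    finally show ?case .
  qed
  have "{\<omega>. \<forall>i\<le>n. \<omega> i = xs i} = IT.PF.emb UNIV {0..<Suc n} (A (Suc n))"
    by (auto simp: A_def prod_emb_def space_PiM PiE_iff less_Suc_eq_le)
  then have "emeasure (chain_measure p x) {\<omega>. \<forall>i\<le>n. \<omega> i = xs i} = emeasure (IT.CI {0..<Suc n}) (A (Suc n))"
    unfolding chain_measure_def using IT.lim[OF _ A_sets] by simp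
  also have "\<dots> = emeasure (IT.C 0 (Suc n) (\<lambda>_. undefined)) (A (Suc n))"
    using IT.emeasure_CI[OF subset_refl A_sets] sets.sets_into_space[OF A_sets[of "Suc n"]]
    by (simp add: prod_emb_id space_PiM del: IT.C.simps)
  finally have "emeasure (chain_measure p x) {\<omega>. \<forall>i\<le>n. \<omega> i = xs i} = ennreal (\<Prod>i<Suc n. K i)"
    unfolding C .
  then have "measure (chain_measure p x) {\<omega>. \<forall>i\<le>n. \<omega> i = xs i} = (\<Prod>i<Suc n. K i)"
    using K_nonneg by (simp add: measure_def prod_nonneg del: prod.lessThan_Suc)
  also have "\<dots> = K 0 * (\<Prod>i<n. K (Suc i))"
    by (rule prod.lessThan_Suc_shift)
  finally show ?thesis by (simp add: K_def)
qed

end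

theory Submission
  imports Defs
begin

text \<open>
  While the chain is at non-constant words it keeps their length \<open>n\<close>, and there it is a random walk
  on a Sierpinski graph with the three corners \<open>1\<^sup>n\<close>, \<open>2\<^sup>n\<close>, \<open>3\<^sup>n\<close>. At a corner the length grows, and
  it never decreases again, so hitting a corner \<open>i\<^sup>n\<close> from a word of length \<open>n\<close> means
  leaving the graph there. First-step analysis therefore makes the hitting probability of a corner a
  harmonic function on words of length \<open>n\<close>, with value \<open>1\<close> at this corner and \<open>0\<close> at the other
  two (\<open>harmonic_rho\<close>, \<open>rho_corner\<close>). Harmonic functions are determined by their corner values
  (\<open>harmonic_unique\<close>, the maximum principle), and this one fact replaces stopping-time arguments:
  it yields the invariance under permutations of the letters, and, because fixing the first letter
  of a harmonic function leaves a harmonic function, the rule that inside a copy \<open>k\<Sigma>\<^sup>n\<close> the value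
  is the average of the values at the corners of the copy, weighted by hitting probabilities of the
  smaller graph (\<open>harmonic_representation\<close>).

  Applying this rule to the three copies that make up the words of length \<open>n + 1\<close> expresses
  \<open>\<alpha>, \<beta>, \<gamma>\<close> at \<open>n + 1\<close> and \<open>a, b, c\<close> at \<open>n + 1\<close> through \<open>a, b, c\<close> at \<open>n\<close>. Let \<open>A, B, C\<close> stand for
  \<open>\<alpha>, \<beta>, \<gamma>\<close> at \<open>n + 1\<close>, and put \<open>s = p b + q c\<close>, \<open>t = q b + p c\<close> with \<open>q = 1 - 2 p\<close>. Then
  \<open>(p + s) A = p B + s\<close>, \<open>(s + t) C = t B\<close> and \<open>A + B + C = 1\<close>, while passing from \<open>n\<close> to \<open>n + 1\<close>
  multiplies \<open>b + c\<close> by \<open>B + C\<close> and \<open>b - c\<close> by \<open>B - C\<close>. Since \<open>A \<ge> B \<ge> C\<close>, the first factor is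
  at most \<open>2/3\<close>, hence \<open>b + c \<rightarrow> 0\<close> and \<open>a \<rightarrow> 1\<close>. The ratio of the two factors is
  \<open>s / (s + 2 t) \<le> 1 / (1 + q)\<close>, hence \<open>b\<close> and \<open>c\<close> become equal relative to their sum and
  \<open>t / (s + t) \<rightarrow> 1/2\<close>. In the limit \<open>A = B = 2 C\<close>, which gives \<open>(2/5, 2/5, 1/5)\<close>.
\<close>

section \<open>Hitting probabilities of the chain\<close>

text \<open>
  The law of the initial segment \<open>[X\<^sub>0, \<dots>, X\<^sub>m]\<close> of the chain started at \<open>x\<close>, as a discrete
  distribution. The recursion splits off the first step, not the last one, so that first-step
  analysis can be read off from it.
\<close>

primrec traj :: "real \<Rightarrow> nat \<Rightarrow> letter list \<Rightarrow> letter list list pmf" where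
  "traj p 0 x = return_pmf [x]"
| "traj p (Suc m) x = bind_pmf (step_pmf p x) (\<lambda>z. map_pmf ((#) x) (traj p m z))"

lemma pmf_traj:
  assumes p: "0 < p" "p < 1/2"
  shows "pmf (traj p m x) xs =
    (if length xs = Suc m \<and> xs ! 0 = x then \<Prod>i<m. trans_prob p (xs ! i) (xs ! Suc i) else 0)"
proof (induction m arbitrary: x xs)
  case 0
  show ?case by (cases xs) (auto simp: pmf_return indicator_def)
next
  case (Suc m)
  show ?case
  proof (cases "\<exists>ys. xs = x # ys")
    case False
    then have "xs \<notin> set_pmf (traj p (Suc m) x)" by auto
    then have "pmf (traj p (Suc m) x) xs = 0" by (simp add: set_pmf_iff del: traj.simps)
    moreover have "\<not> (length xs = Suc (Suc m) \<and> xs ! 0 = x)" using False by (cases xs) auto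
    ultimately show ?thesis by (simp only: if_False)
  next
    case True
    then obtain ys where xs: "xs = x # ys" by blast
    define K where "K = (if length ys = Suc m then \<Prod>i<m. trans_prob p (ys ! i) (ys ! Suc i) else 0)"
    have K: "pmf (map_pmf ((#) x) (traj p m z)) xs = K * indicator {ys ! 0} z" for z
      unfolding xs by (subst pmf_map_inj') (auto simp: Suc.IH K_def inj_def)
    have "pmf (traj p (Suc m) x) xs = K * trans_prob p x (ys ! 0)"
      by (simp add: pmf_bind K measure_pmf_single pmf_step[OF p])
    also have "\<dots> = (if length xs = Suc (Suc m) \<and> xs ! 0 = x
        then \<Prod>i<Suc m. trans_prob p (xs ! i) (xs ! Suc i) else 0)"
      unfolding prod.lessThan_Suc_shift by (simp add: xs K_def)
    finally show ?thesis .
  qed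
qed

lemma prefix_eq_iff:
  "map \<omega> [0..<n] = xs \<longleftrightarrow> length xs = n \<and> (\<forall>i<n. \<omega> i = xs ! i)"
  by (auto simp: list_eq_iff_nth_eq)

lemma measurable_prefix [measurable]:
  "(\<lambda>\<omega>. map \<omega> [0..<n]) \<in> measurable (chain_measure p x) (count_space UNIV)"
proof -
  have "{\<omega>. map \<omega> [0..<n] = xs} \<in> sets (chain_measure p x)" for xs
  proof -
    have "{\<omega>. map \<omega> [0..<n] = xs} =
        {\<omega> \<in> space (chain_measure p x). length xs = n \<and> (\<forall>i<n. \<omega> i = xs ! i)}"
      by (simp add: prefix_eq_iff)
    also have "\<dots> \<in> sets (chain_measure p x)" by measurable
    finally show ?thesis .
  qed
  then show ?thesis
    by (auto simp: measurable_count_space_eq2_countable vimage_def)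
qed

text \<open>
  Initial segments take countably many values, so it is enough to compare probabilities of
  single segments, and these are the cylinder probabilities.
\<close>

lemma distr_prefix:
  assumes p: "0 < p" "p < 1/2"
  shows "distr (chain_measure p x) (count_space UNIV) (\<lambda>\<omega>. map \<omega> [0..<Suc m]) =
    measure_pmf (traj p m x)"
proof (rule measure_eqI_countable[of _ UNIV])
  fix xs :: "letter list list"
  interpret prob_space "chain_measure p x" by (rule prob_space_chain_measure)
  have "(\<lambda>\<omega>. map \<omega> [0..<Suc m]) -` {xs} \<inter> space (chain_measure p x) =
      (if length xs = Suc m then {\<omega>. \<forall>i\<le>m. \<omega> i = xs ! i} else {})"
    unfolding vimage_def by (simp add: prefix_eq_iff less_Suc_eq_le del: upt_Suc)
  then have "emeasure (distr (chain_measure p x) (count_space UNIV) (\<lambda>\<omega>. map \<omega> [0..<Suc m])) {xs} =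
      ennreal (if length xs = Suc m then prob {\<omega>. \<forall>i\<le>m. \<omega> i = xs ! i} else 0)"
    by (simp add: emeasure_distr emeasure_eq_measure del: upt_Suc)
  also have "\<dots> = ennreal (pmf (traj p m x) xs)"
    using chain_measure_cylinder[OF p, of x m "\<lambda>i. xs ! i"] by (simp add: pmf_traj[OF p])
  finally show "emeasure (distr (chain_measure p x) (count_space UNIV) (\<lambda>\<omega>. map \<omega> [0..<Suc m])) {xs} =
      emeasure (measure_pmf (traj p m x)) {xs}"
    by (simp add: emeasure_pmf_single)
qed auto

definition hit :: "real \<Rightarrow> letter list \<Rightarrow> nat \<Rightarrow> letter list \<Rightarrow> real" where
  "hit p y m x = measure (traj p m x) {xs. y \<in> set xs}"

lemma hit_tendsto_rho:
  assumes p: "0 < p" "p < 1/2"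
  shows "(\<lambda>m. hit p y m x) \<longlonglongrightarrow> rho p x y"
proof -
  interpret prob_space "chain_measure p x" by (rule prob_space_chain_measure)
  have ev [measurable]: "{\<omega>. \<exists>k<n. \<omega> k = y} \<in> events" for n
  proof -
    have "{\<omega> \<in> space (chain_measure p x). \<exists>k<n. \<omega> k = y} \<in> events" by measurable
    then show ?thesis by simp
  qed
  have "hit p y m x = prob {\<omega>. \<exists>k<Suc m. \<omega> k = y}" for m
  proof -
    have "(\<lambda>\<omega>. map \<omega> [0..<Suc m]) -` {xs. y \<in> set xs} = {\<omega>. \<exists>k<Suc m. \<omega> k = y}"
      by (auto simp del: upt_Suc)
    then show ?thesis
      unfolding hit_def distr_prefix[OF p, symmetric]
      by (subst measure_distr) (simp_all del: upt_Suc)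
  qed
  moreover have "(\<lambda>m. prob {\<omega>. \<exists>k<Suc m. \<omega> k = y}) \<longlonglongrightarrow> prob (\<Union>m. {\<omega>. \<exists>k<Suc m. \<omega> k = y})"
    by (rule finite_Lim_measure_incseq) (use ev in \<open>auto simp: incseq_def intro: less_le_trans\<close>)
  moreover have "(\<Union>m. {\<omega>. \<exists>k<Suc m. \<omega> k = y}) = {\<omega>. \<exists>k. \<omega> k = y}" by auto
  ultimately show ?thesis unfolding rho_def by simp
qed

lemma set_traj_hd: "xs \<in> set_pmf (traj p m x) \<Longrightarrow> x \<in> set xs"
  by (cases m) auto

lemma rho_refl:
  assumes p: "0 < p" "p < 1/2"
  shows "rho p x x = 1"
proof -
  have "hit p x m x = 1" for m
    unfolding hit_def
    by (simp add: measure_pmf.prob_eq_1 AE_measure_pmf_iff set_traj_hd)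
  then have "(\<lambda>m. hit p x m x) \<longlonglongrightarrow> 1" by simp
  then show ?thesis by (rule LIMSEQ_unique[OF hit_tendsto_rho[OF p]])
qed

lemma rho_nonneg: "rho p x y \<ge> 0"
  unfolding rho_def by simp

text \<open>
  The finite set \<open>A\<close> of possible successors lets the first-step equation for the first \<open>m\<close> steps
  pass to the limit summand by summand.
\<close>

lemma rho_first_step:
  assumes p: "0 < p" "p < 1/2" and ne: "x \<noteq> y"
    and A: "finite A" "\<And>v. v \<notin> A \<Longrightarrow> trans_prob p x v = 0"
  shows "rho p x y = (\<Sum>v\<in>A. trans_prob p x v * rho p v y)"
proof -
  have "hit p y (Suc m) x = (\<Sum>v\<in>A. trans_prob p x v * hit p y m v)" for m
  proof -
    have "ennreal (hit p y (Suc m) x) = (\<integral>\<^sup>+z. ennreal (hit p y m z) \<partial>step_pmf p x)"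
      unfolding hit_def traj.simps measure_pmf.emeasure_eq_measure[symmetric]
      using ne by (auto simp: vimage_def)
    also have "\<dots> = (\<Sum>v\<in>A. ennreal (hit p y m v) * ennreal (pmf (step_pmf p x) v))"
      using A by (intro nn_integral_measure_pmf_support) (auto simp: set_pmf_iff pmf_step[OF p])
    also have "\<dots> = ennreal (\<Sum>v\<in>A. trans_prob p x v * hit p y m v)"
      by (subst sum_ennreal[symmetric])
        (auto simp: hit_def pmf_step[OF p] trans_prob_stochastic(1)[OF p] ennreal_mult mult.commute)
    finally have "ennreal (hit p y (Suc m) x) = ennreal (\<Sum>v\<in>A. trans_prob p x v * hit p y m v)" .
    then show ?thesis
      by (subst (asm) ennreal_inj)
        (auto simp: hit_def intro!: sum_nonneg mult_nonneg_nonneg trans_prob_stochastic(1)[OF p])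
  qed
  moreover have "(\<lambda>m. \<Sum>v\<in>A. trans_prob p x v * hit p y m v) \<longlonglongrightarrow>
      (\<Sum>v\<in>A. trans_prob p x v * rho p v y)"
    by (intro tendsto_intros hit_tendsto_rho p)
  ultimately have "(\<lambda>m. hit p y (Suc m) x) \<longlonglongrightarrow> (\<Sum>v\<in>A. trans_prob p x v * rho p v y)"
    by simp
  then show ?thesis
    by (rule LIMSEQ_unique[OF hit_tendsto_rho[OF p, of y x, THEN LIMSEQ_Suc]])
qed

lemma trans_prob_length:
  assumes "trans_prob p u v \<noteq> 0"
  shows "length u \<le> length v"
  using assms unfolding trans_prob_def by (auto split: if_splits)

lemma traj_length:
  assumes p: "0 < p" "p < 1/2"
  shows "xs \<in> set_pmf (traj p m x) \<Longrightarrow> v \<in> set xs \<Longrightarrow> length x \<le> length v"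
proof (induction m arbitrary: x xs)
  case (Suc m)
  from Suc.prems(1) obtain z ys where z: "z \<in> set_pmf (step_pmf p x)"
    and ys: "ys \<in> set_pmf (traj p m z)" "xs = x # ys" by auto
  have "length x \<le> length z" using z by (auto simp: set_pmf_iff pmf_step[OF p] intro: trans_prob_length)
  with ys Suc show ?case by fastforce
qed auto

lemma rho_shorter:
  assumes p: "0 < p" "p < 1/2" and "length y < length x"
  shows "rho p x y = 0"
proof -
  have "hit p y m x = 0" for m
    unfolding hit_def using traj_length[OF p, of _ m x y] assms(3)
    by (subst measure_pmf_zero_iff) fastforce
  then have "(\<lambda>m. hit p y m x) \<longlonglongrightarrow> 0" by simp
  then show ?thesis by (rule LIMSEQ_unique[OF hit_tendsto_rho[OF p]])
qed

text \<open>
  From \<open>j\<^sup>n\<close> the chain moves on to words of length \<open>n + 1\<close> and cannot come back. For \<open>n = 0\<close> all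
  corners are the empty word.
\<close>

lemma rho_corner:
  assumes p: "0 < p" "p < 1/2" and "n \<ge> 1"
  shows "rho p (replicate n j) (replicate n i) = (if i = j then 1 else 0)"
proof (cases "i = j")
  case False
  have "rho p (replicate n j) (replicate n i) =
    (\<Sum>v\<in>range (\<lambda>k. replicate n j @ [k]). trans_prob p (replicate n j) v * rho p v (replicate n i))"
    using False \<open>n \<ge> 1\<close> by (intro rho_first_step p) (auto simp: trans_prob_const replicate_eq_replicate)
  also have "\<dots> = 0" by (intro sum.neutral) (auto simp: rho_shorter[OF p])
  finally show ?thesis using False by simp
qed (simp add: rho_refl[OF p])

section \<open>Harmonic functions on the words of a fixed length\<close>

text \<open>
  The mean value property at the non-constant words of length \<open>n\<close>; the corners \<open>i\<^sup>n\<close> are the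
  boundary, at which nothing is required.
\<close>

definition harmonic :: "real \<Rightarrow> nat \<Rightarrow> (letter list \<Rightarrow> real) \<Rightarrow> bool" where
  "harmonic p n h \<longleftrightarrow> (\<forall>w i j l m. distinct [i, j, l] \<longrightarrow> length w + m + 2 = n \<longrightarrow>
     h (w @ [i] @ replicate (Suc m) j) =
       p * h (w @ [j] @ replicate (Suc m) i) + p * h (w @ [i] @ replicate m j @ [i]) +
       (1 - 2 * p) * h (w @ [i] @ replicate m j @ [l]))"

lemma harmonicD:
  assumes "harmonic p n h" "distinct [i, j, l]" "length w + m + 2 = n"
  shows "h (w @ [i] @ replicate (Suc m) j) =
       p * h (w @ [j] @ replicate (Suc m) i) + p * h (w @ [i] @ replicate m j @ [i]) +
       (1 - 2 * p) * h (w @ [i] @ replicate m j @ [l])"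
  using assms unfolding harmonic_def by blast

lemma harmonic_rho:
  assumes p: "0 < p" "p < 1/2"
  shows "harmonic p n (\<lambda>u. rho p u (replicate n k))"
  unfolding harmonic_def
proof (intro allI impI)
  fix w :: "letter list" and i j l :: letter and m
  assume d: "distinct [i, j, l]" and "length w + m + 2 = n"
  let ?u = "w @ [i] @ replicate (Suc m) j"
  let ?x = "w @ [j] @ replicate (Suc m) i"
  let ?y = "w @ [i] @ replicate m j @ [i]"
  let ?z = "w @ [i] @ replicate m j @ [l]"
  have n: "?x \<noteq> ?y" "?x \<noteq> ?z" "?y \<noteq> ?z" using d by auto
  note t = trans_prob_split[OF d, of p w m]
  have v: "trans_prob p ?u ?x = p" "trans_prob p ?u ?y = p" "trans_prob p ?u ?z = 1 - 2 * p"
    unfolding t using n by presburger+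
  have "rho p ?u (replicate n k) = (\<Sum>v\<in>{?x, ?y, ?z}. trans_prob p ?u v * rho p v (replicate n k))"
  proof (rule rho_first_step[OF p])
    show "?u \<noteq> replicate n k" by (rule split_nonconst) (use d in auto)
    show "trans_prob p ?u v = 0" if "v \<notin> {?x, ?y, ?z}" for v
      using that unfolding t by simp
  qed simp
  also have "\<dots> = trans_prob p ?u ?x * rho p ?x (replicate n k) +
      (trans_prob p ?u ?y * rho p ?y (replicate n k) + trans_prob p ?u ?z * rho p ?z (replicate n k))"
    using n by (subst sum.insert, simp, blast, subst sum.insert, simp, blast, simp)
  finally show "rho p ?u (replicate n k) = p * rho p ?x (replicate n k) +
      p * rho p ?y (replicate n k) + (1 - 2 * p) * rho p ?z (replicate n k)" unfolding v by simp
qed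

lemma harmonic_add: "harmonic p n g \<Longrightarrow> harmonic p n h \<Longrightarrow> harmonic p n (\<lambda>u. g u + h u)"
  unfolding harmonic_def by (simp add: algebra_simps)

lemma harmonic_cmult:
  fixes c :: real
  assumes "harmonic p n h"
  shows "harmonic p n (\<lambda>u. c * h u)"
  unfolding harmonic_def by (intro allI impI) (subst harmonicD[OF assms], auto simp: algebra_simps)

text \<open>
  The graph on words of length \<open>n + 1\<close> consists of three copies of the graph on words of length
  \<open>n\<close>: a transition from a word whose tail is non-constant does not touch the first letter.
\<close>

lemma harmonic_Cons: "harmonic p (Suc n) h \<Longrightarrow> harmonic p n (\<lambda>u. h (k # u))"
  unfolding harmonic_def
proof (intro allI impI, goal_cases)
  case (1 w i j l m)
  then show ?case by (elim allE[of _ "k # w"] allE[of _ i] allE[of _ j] allE[of _ l] allE[of _ m]) simp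
qed

lemma harmonic_map:
  assumes "harmonic p n h" "inj f"
  shows "harmonic p n (\<lambda>u. h (map f u))"
  unfolding harmonic_def
proof (intro allI impI)
  fix w :: "letter list" and i j l :: letter and m
  assume d: "distinct [i, j, l]" and n: "length w + m + 2 = n"
  have "distinct [f i, f j, f l]" using d assms(2) by (auto dest: injD)
  from harmonicD[OF assms(1) this, of "map f w" m] n
  show "h (map f (w @ [i] @ replicate (Suc m) j)) =
       p * h (map f (w @ [j] @ replicate (Suc m) i)) + p * h (map f (w @ [i] @ replicate m j @ [i])) +
       (1 - 2 * p) * h (map f (w @ [i] @ replicate m j @ [l]))"
    by (simp del: replicate.simps)
qed

text \<open>
  From every word some corner can be reached. Indeed, as long as no constant word stops the walk,
  for each prefix \<open>w\<close> each corner \<open>w k\<^sup>r\<close> of the copy with prefix \<open>w\<close> can be reached from each word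
  of this copy; the empty prefix then gives the constant words themselves. To go from
  \<open>w a y\<close> to \<open>w k\<^sup>r\<^sup>+\<^sup>1\<close>, walk inside the smaller copy with prefix \<open>w a\<close> to its corner \<open>w a k\<^sup>r\<close>, cross
  over to \<open>w k a\<^sup>r\<close>, and walk inside the copy with prefix \<open>w k\<close> to \<open>w k k\<^sup>r\<close>. For \<open>r = 0\<close> there is
  nothing to cross, and it is only needed that the last letter of a non-constant word can be
  changed into either of the other two.
\<close>

lemma closed_contains_corner:
  fixes S :: "letter list set"
  assumes closed: "\<And>w i j l m. distinct [i, j, l] \<Longrightarrow> w @ [i] @ replicate (Suc m) j \<in> S \<Longrightarrow>
      w @ [j] @ replicate (Suc m) i \<in> S \<and> w @ [i] @ replicate m j @ [i] \<in> S \<and>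
      w @ [i] @ replicate m j @ [l] \<in> S"
    and ne: "u \<in> S"
  shows "\<exists>n k. replicate n k \<in> S"
proof (rule ccontr)
  \<comment> \<open>Without constant words in \<open>S\<close>, every word of \<open>S\<close> may be moved, and the closure property
    applies along the whole path.\<close>
  assume no: "\<not> ?thesis"
  have "w @ replicate r k \<in> S" if "w @ x \<in> S" "length x = r" for w x r k
    using that
  proof (induction r arbitrary: w x k)
    case (Suc r)
    then obtain a y where x: "x = a # y" "length y = r" by (cases x) auto
    have 1: "w @ [a] @ replicate r k \<in> S"
      using Suc.IH[of "w @ [a]" y k] Suc.prems x by simp
    show ?case
    proof (cases "a = k")
      case True
      then show ?thesis using 1 by simp
    next
      case ne: False
      obtain l where d: "distinct [a, k, l]" using third_letter[OF ne] by blast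
      show ?thesis
      proof (cases r)
        case r: (Suc m)
        have "(w @ [k]) @ replicate r a \<in> S"
          using closed[OF d, of w m] 1 r by simp
        then show ?thesis using Suc.IH[of "w @ [k]" "replicate r a" k] by simp
      next
        case 0
        then have "w @ [a] \<in> S" using 1 by simp
        then have "\<not> (\<exists>n i. w @ [a] = replicate n i)" using no by metis
        then obtain w' i j m where ij: "i \<noteq> j" and u: "w @ [a] = w' @ [i] @ replicate (Suc m) j"
          using split_exists by blast
        have "w @ [a] = (w' @ [i] @ replicate m j) @ [j]"
          unfolding u by (simp add: replicate_append_same)
        then have w: "w = w' @ [i] @ replicate m j" "a = j" by simp_all
        obtain l' where d': "distinct [i, j, l']" using third_letter[OF ij] by blast
        have "k = i \<or> k = l'" using d' ne w(2) by (cases i; cases j; cases l'; cases k; simp)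
        moreover have "w @ [i] \<in> S \<and> w @ [l'] \<in> S"
          using closed[OF d', of w' m] \<open>w @ [a] \<in> S\<close> unfolding u by (simp add: w)
        ultimately show ?thesis using 0 by auto
      qed
    qed
  qed simp
  from this[of "[]" u "length u"] ne no show False by auto
qed

text \<open>
  The maximum principle: since \<open>p\<close> and \<open>1 - 2 p\<close> are positive, the set of words at which a
  harmonic function is maximal is closed under the transitions from non-constant words, so it
  contains a corner.
\<close>

lemma harmonic_le_0:
  assumes p: "0 < p" "p < 1/2" and h: "harmonic p n h"
    and corner: "\<And>k. h (replicate n k) \<le> 0" and u: "length u = n"
  shows "h u \<le> 0"
proof -
  define W where "W = {u :: letter list. length u = n}"
  have fin: "finite W" using finite_lists_length_eq[of "UNIV :: letter set" n] by (simp add: W_def)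
  have uW: "u \<in> W" using u by (simp add: W_def)
  define M where "M = Max (h ` W)"
  have le: "h v \<le> M" if "length v = n" for v using that fin by (simp add: M_def W_def)
  define S where "S = {v \<in> W. h v = M}"
  have "M \<in> h ` W" unfolding M_def using fin uW by (intro Max_in) auto
  then obtain v where v: "v \<in> S" unfolding S_def by auto
  have "\<exists>n k. replicate n k \<in> S"
  proof (rule closed_contains_corner[OF _ v])
    fix w i j l m
    assume d: "distinct [i, j, l]" and S: "w @ [i] @ replicate (Suc m) j \<in> S"
    then have n: "length w + m + 2 = n" and hM: "h (w @ [i] @ replicate (Suc m) j) = M"
      by (auto simp: S_def W_def)
    let ?x = "w @ [j] @ replicate (Suc m) i"
    let ?y = "w @ [i] @ replicate m j @ [i]"
    let ?z = "w @ [i] @ replicate m j @ [l]"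
    have l: "length ?x = n" "length ?y = n" "length ?z = n" using n by auto
    have nn: "p * (M - h ?x) \<ge> 0" "p * (M - h ?y) \<ge> 0" "(1 - 2 * p) * (M - h ?z) \<ge> 0"
      using le[OF l(1)] le[OF l(2)] le[OF l(3)] p by (auto intro!: mult_nonneg_nonneg simp del: replicate.simps)
    have "M = p * h ?x + p * h ?y + (1 - 2 * p) * h ?z"
      using harmonicD[OF h d n] unfolding hM .
    then have "p * (M - h ?x) + p * (M - h ?y) + (1 - 2 * p) * (M - h ?z) = 0"
      by (simp add: algebra_simps)
    then have "p * (M - h ?x) = 0" "p * (M - h ?y) = 0" "(1 - 2 * p) * (M - h ?z) = 0"
      using nn by linarith+
    then have "h ?x = M" "h ?y = M" "h ?z = M" using p by auto
    then show "?x \<in> S \<and> ?y \<in> S \<and> ?z \<in> S" using l unfolding S_def W_def by blast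
  qed
  then obtain n' k where "replicate n' k \<in> S" by blast
  then have "h (replicate n k) = M" by (auto simp: S_def W_def)
  then show ?thesis using corner[of k] le[OF u] by simp
qed

lemma harmonic_unique:
  assumes p: "0 < p" "p < 1/2" and g: "harmonic p n g" and h: "harmonic p n h"
    and corner: "\<And>k. g (replicate n k) = h (replicate n k)" and u: "length u = n"
  shows "g u = h u"
proof -
  have "g u + (-1) * h u \<le> 0"
    by (rule harmonic_le_0[OF p harmonic_add[OF g harmonic_cmult[OF h]] _ u]) (simp add: corner)
  moreover have "h u + (-1) * g u \<le> 0"
    by (rule harmonic_le_0[OF p harmonic_add[OF h harmonic_cmult[OF g]] _ u]) (simp add: corner)
  ultimately show ?thesis by simp
qed

text \<open>
  Both sides are harmonic and have the same corner values. For \<open>n = 0\<close> the right-hand side would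
  count the value at the empty word three times.
\<close>

lemma harmonic_representation:
  assumes p: "0 < p" "p < 1/2" and h: "harmonic p n h" and n: "n \<ge> 1"
    and d: "distinct [i, j, l]" and u: "length u = n"
  shows "h u = h (replicate n i) * rho_letter p i u + h (replicate n j) * rho_letter p j u +
    h (replicate n l) * rho_letter p l u"
proof -
  have "h u = h (replicate n i) * rho p u (replicate n i) + h (replicate n j) * rho p u (replicate n j) +
    h (replicate n l) * rho p u (replicate n l)"
  proof (rule harmonic_unique[OF p h _ _ u])
    show "harmonic p n (\<lambda>u. h (replicate n i) * rho p u (replicate n i) +
        h (replicate n j) * rho p u (replicate n j) + h (replicate n l) * rho p u (replicate n l))"
      by (intro harmonic_add harmonic_cmult harmonic_rho p)
    fix k
    have "k = i \<or> k = j \<or> k = l" using d by (cases i; cases j; cases l; cases k; simp)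
    then show "h (replicate n k) = h (replicate n i) * rho p (replicate n k) (replicate n i) +
        h (replicate n j) * rho p (replicate n k) (replicate n j) +
        h (replicate n l) * rho p (replicate n k) (replicate n l)"
      using d by (auto simp: rho_corner[OF p n])
  qed
  then show ?thesis unfolding rho_letter_def u .
qed

text \<open>
  The chain is invariant under permutations of the letters; here this comes from uniqueness, as
  harmonicity and the corner values are invariant.
\<close>

lemma rho_letter_map:
  assumes p: "0 < p" "p < 1/2" and f: "inj f" and u: "u \<noteq> []"
  shows "rho_letter p (f k) (map f u) = rho_letter p k u"
proof -
  have n: "length u \<ge> 1" using u by (cases u) auto
  have "rho p (map f u) (replicate (length u) (f k)) = rho p u (replicate (length u) k)"
    by (rule harmonic_unique[OF p harmonic_map[OF harmonic_rho[OF p] f] harmonic_rho[OF p]])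
      (auto simp: rho_corner[OF p n] inj_eq[OF f])
  then show ?thesis by (simp add: rho_letter_def)
qed

lemma relabelling_exists:
  assumes "distinct [i, j, l]"
  obtains f where "inj f" "f L1 = i" "f L2 = j" "f L3 = l"
proof (rule that[of "case_letter i j l"])
  show "inj (case_letter i j l)"
    using assms by (intro injI) (auto split: letter.splits)
qed auto

text \<open>
  By symmetry the six sequences, defined through particular letters, give the hitting
  probabilities for any three distinct letters.
\<close>

lemma rho_letter_far:
  assumes p: "0 < p" "p < 1/2" and d: "distinct [i, j, l]"
  shows "rho_letter p i (i # replicate n j) = alpha_seq p (Suc n)"
    "rho_letter p j (i # replicate n j) = beta_seq p (Suc n)"
    "rho_letter p l (i # replicate n j) = gamma_seq p (Suc n)"
proof -
  obtain f where f: "inj f" and [simp]: "f L1 = i" "f L2 = j" "f L3 = l"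
    using relabelling_exists[OF d] .
  note r = rho_letter_map[OF p f, of "L1 # replicate n L2"]
  show "rho_letter p i (i # replicate n j) = alpha_seq p (Suc n)"
    "rho_letter p j (i # replicate n j) = beta_seq p (Suc n)"
    "rho_letter p l (i # replicate n j) = gamma_seq p (Suc n)"
    using r[of L1] r[of L2] r[of L3] by (simp_all add: alpha_seq_def beta_seq_def gamma_seq_def)
qed

lemma rho_letter_near:
  assumes p: "0 < p" "p < 1/2" and d: "distinct [i, j, l]"
  shows "rho_letter p i (replicate n i @ [j]) = a_seq p (Suc n)"
    "rho_letter p j (replicate n i @ [j]) = b_seq p (Suc n)"
    "rho_letter p l (replicate n i @ [j]) = c_seq p (Suc n)"
proof -
  obtain f where f: "inj f" and [simp]: "f L1 = i" "f L2 = j" "f L3 = l"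
    using relabelling_exists[OF d] .
  note r = rho_letter_map[OF p f, of "replicate n L1 @ [L2]"]
  show "rho_letter p i (replicate n i @ [j]) = a_seq p (Suc n)"
    "rho_letter p j (replicate n i @ [j]) = b_seq p (Suc n)"
    "rho_letter p l (replicate n i @ [j]) = c_seq p (Suc n)"
    using r[of L1] r[of L2] r[of L3] by (simp_all add: a_seq_def b_seq_def c_seq_def)
qed

lemma harmonic_near_corner_of_copy:
  assumes p: "0 < p" "p < 1/2" and h: "harmonic p (Suc (Suc n)) h" and d: "distinct [i, j, l]"
  shows "h (k # replicate n i @ [j]) = a_seq p (Suc n) * h (k # replicate (Suc n) i) +
    b_seq p (Suc n) * h (k # replicate (Suc n) j) + c_seq p (Suc n) * h (k # replicate (Suc n) l)"
  using harmonic_representation[OF p harmonic_Cons[OF h] _ d, of "replicate n i @ [j]" k]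
  unfolding rho_letter_near[OF p d] by (simp add: mult.commute)

text \<open>
  The word \<open>i j\<^sup>n\<^sup>+\<^sup>1\<close> is the corner of the copy \<open>i\<close> at which it is joined to the copy \<open>j\<close>. One of its
  neighbours lies across the junction; the other two lie in the copy \<open>i\<close> next to this corner, so
  their values are averages of the corner values of this copy, the starting word included.
\<close>

lemma harmonic_at_junction:
  assumes p: "0 < p" "p < 1/2" and h: "harmonic p (Suc (Suc n)) h" and d: "distinct [i, j, l]"
  shows "h (i # replicate (Suc n) j) = p * h (j # replicate (Suc n) i) +
    p * (a_seq p (Suc n) * h (i # replicate (Suc n) j) + b_seq p (Suc n) * h (i # replicate (Suc n) i) +
      c_seq p (Suc n) * h (i # replicate (Suc n) l)) +
    (1 - 2 * p) * (a_seq p (Suc n) * h (i # replicate (Suc n) j) +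
      b_seq p (Suc n) * h (i # replicate (Suc n) l) + c_seq p (Suc n) * h (i # replicate (Suc n) i))"
proof -
  have d': "distinct [j, i, l]" "distinct [j, l, i]" using d by auto
  show ?thesis
    using harmonicD[OF h d, of "[]" n]
    unfolding harmonic_near_corner_of_copy[OF p h d'(1), of i, symmetric]
      harmonic_near_corner_of_copy[OF p h d'(2), of i, symmetric] by simp
qed

section \<open>The recursion over the length of the words\<close>

text \<open>
  The recursion that self-similarity imposes on the hitting probabilities, as a statement about
  six real sequences. At index \<open>n\<close>, the triple \<open>a, b, c\<close> belongs to the walk started at \<open>i\<^sup>n j\<close>, next
  to a corner: it hits the corner of \<open>i\<close>, of \<open>j\<close>, or of the third letter. The triple \<open>A, B, C\<close>
  belongs to the walk on the next larger triangle started at the junction \<open>i j\<^sup>n\<^sup>+\<^sup>1\<close> of its copies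
  and lists the corners in the same order, so \<open>A\<close> goes with the copy that contains the start and
  \<open>B\<close> with the copy across the junction. The junction equations split according to the first step;
  their summands \<open>a n * A n\<close>, \<open>a n * B n\<close> and \<open>a n * C n\<close> come from returns to the start. Index
  \<open>0\<close> is the triangle of side one, where the word \<open>j\<close> next to the corner \<open>i\<close> is itself a corner.
\<close>

locale corner_recursion =
  fixes p :: real and a b c A B C :: "nat \<Rightarrow> real"
  assumes p: "0 < p" "p < 1/2"
    and nonneg: "A n \<ge> 0" "B n \<ge> 0" "C n \<ge> 0"
    and init: "a 0 = 0" "b 0 = 1" "c 0 = 0"
    and A_eq: "A n = p * B n + p * (a n * A n + b n + c n * A n) +
      (1 - 2 * p) * (a n * A n + b n * A n + c n)"
    and B_eq: "B n = p * A n + p * (a n * B n + c n * C n) + (1 - 2 * p) * (a n * B n + b n * C n)"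
    and C_eq: "C n = p * C n + p * (a n * C n + c n * B n) + (1 - 2 * p) * (a n * C n + b n * B n)"
    and a_Suc: "a (Suc n) = a n + b n * A n + c n * A n"
    and b_Suc: "b (Suc n) = b n * B n + c n * C n"
    and c_Suc: "c (Suc n) = b n * C n + c n * B n"
begin

definition q :: real where "q = 1 - 2 * p"

text \<open>
  From the junction \<open>i j\<^sup>n\<close> the walk either crosses, with probability \<open>p\<close>, or makes an excursion
  into its copy, which lasts until it next meets a corner of the copy. This excursion takes place
  and ends at the outer corner of the copy with probability \<open>s\<close>, and at the other junction with
  probability \<open>t\<close>.
\<close>

definition s :: "nat \<Rightarrow> real" where "s n = p * b n + q * c n"
definition t :: "nat \<Rightarrow> real" where "t n = q * b n + p * c n"

lemma q_pos: "q > 0"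
  using p by (simp add: q_def)

text \<open>
  Once \<open>a + b + c = 1\<close> is known, returns to the junction can be cancelled, and the equations at
  the junctions become those of a walk on the six junctions that crosses with weight \<open>p\<close>, is
  absorbed with weight \<open>s\<close> and passes to the other junction of the copy with weight \<open>t\<close>. Adding
  the three equations gives \<open>s (A + B + C) = s\<close>.
\<close>

lemma junction_equations:
  assumes abc: "a n + b n + c n = 1" "b n > 0" "c n \<ge> 0"
  shows "s n > 0" "t n > 0"
    and "(p + s n) * A n = p * B n + s n" "(s n + t n) * C n = t n * B n"
    and "A n + B n + C n = 1" "A n \<ge> B n" "B n \<ge> C n" "B n > 0"
proof -
  show pos: "s n > 0" "t n > 0"
    using abc p q_pos unfolding s_def t_def by (auto intro: add_pos_nonneg)
  have an: "a n = 1 - b n - c n" using abc by simp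
  show 1: "(p + s n) * A n = p * B n + s n"
    using A_eq[of n] unfolding an s_def q_def by algebra
  have 2: "(p + s n + t n) * B n = p * A n + t n * C n"
    using B_eq[of n] unfolding an s_def t_def q_def by algebra
  show 3: "(s n + t n) * C n = t n * B n"
    using C_eq[of n] unfolding an s_def t_def q_def by algebra
  have "s n * (A n + B n + C n) = s n * 1" using 1 2 3 by (simp add: algebra_simps)
  then show sum: "A n + B n + C n = 1" using pos by simp
  have "(p + s n) * (A n - B n) = s n * (1 - B n)" using 1 by (simp add: algebra_simps)
  also have "\<dots> \<ge> 0" using pos sum nonneg[of n] by (intro mult_nonneg_nonneg) auto
  finally show "A n \<ge> B n" using pos p by (simp add: zero_le_mult_iff)
  have "t n * (B n - C n) = s n * C n" using 3 by (simp add: algebra_simps)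
  then show BC: "B n \<ge> C n" using pos nonneg[of n] by (smt (verit) mult_pos_neg mult_nonneg_nonneg)
  have "B n \<noteq> 0"
  proof
    assume "B n = 0"
    then have "p * A n = 0" using 2 nonneg[of n] BC by simp
    then show False using sum p nonneg[of n] \<open>B n = 0\<close> BC by simp
  qed
  then show "B n > 0" using nonneg[of n] by (simp add: less_le)
qed

text \<open>
  The step from \<open>(b, c)\<close> to the next pair is a symmetric circulant matrix, diagonalised by the sum
  and the difference.
\<close>

lemma sum_step: "b (Suc n) + c (Suc n) = (b n + c n) * (B n + C n)"
  and diff_step: "b (Suc n) - c (Suc n) = (b n - c n) * (B n - C n)"
  by (simp_all add: b_Suc c_Suc algebra_simps)

lemma invariant: "a n + b n + c n = 1 \<and> b n > 0 \<and> c n \<ge> 0 \<and> b n \<ge> c n"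
proof (induction n)
  case 0
  show ?case by (simp add: init)
next
  case (Suc n)
  then have abc: "a n + b n + c n = 1" "b n > 0" "c n \<ge> 0" "b n \<ge> c n" by auto
  note f = junction_equations[OF abc(1-3)]
  have "b n + c n = (b n + c n) * (A n + B n + C n)" using f by simp
  then have "a (Suc n) + b (Suc n) + c (Suc n) = 1"
    unfolding a_Suc b_Suc c_Suc using abc(1) by (simp add: algebra_simps)
  moreover have "b (Suc n) > 0"
    unfolding b_Suc using abc f nonneg[of n] by (simp add: add_pos_nonneg)
  moreover have "c (Suc n) \<ge> 0" unfolding c_Suc using abc nonneg[of n] by simp
  moreover have "b (Suc n) - c (Suc n) \<ge> 0"
    unfolding diff_step using abc f by (intro mult_nonneg_nonneg) auto
  ultimately show ?case by simp
qed

lemma junction_facts: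
  "s n > 0" "t n > 0" "(p + s n) * A n = p * B n + s n" "(s n + t n) * C n = t n * B n"
  "A n + B n + C n = 1" "A n \<ge> B n" "B n \<ge> C n" "B n > 0"
  using invariant[of n] junction_equations[of n] by auto

text \<open>Since \<open>A\<close> is the largest of three numbers with sum \<open>1\<close>, \<open>B + C \<le> 2/3\<close>.\<close>

lemma sum_le: "b n + c n \<le> (2/3) ^ n"
proof (induction n)
  case 0
  show ?case by (simp add: init)
next
  case (Suc n)
  have "(b n + c n) * (B n + C n) \<le> (2/3) ^ n * (2/3)"
    using Suc invariant[of n] junction_facts[of n] nonneg[of n] by (intro mult_mono) auto
  then show ?case by (simp add: sum_step)
qed

lemma sum_tendsto: "(\<lambda>n. b n + c n) \<longlonglongrightarrow> 0"
proof (rule tendsto_sandwich[OF _ _ tendsto_const])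
  show "(\<lambda>n. (2/3) ^ n :: real) \<longlonglongrightarrow> 0" by (rule LIMSEQ_realpow_zero) auto
  show "\<forall>\<^sub>F n in sequentially. b n + c n \<le> (2/3) ^ n" by (simp add: sum_le)
  show "\<forall>\<^sub>F n in sequentially. 0 \<le> b n + c n"
    using invariant by (auto simp: less_imp_le intro: add_nonneg_nonneg)
qed

lemma near_limits: "a \<longlonglongrightarrow> 1" "b \<longlonglongrightarrow> 0" "c \<longlonglongrightarrow> 0"
proof -
  have "a = (\<lambda>n. 1 - (b n + c n))" using invariant by (auto simp: fun_eq_iff algebra_simps)
  then show "a \<longlonglongrightarrow> 1" using tendsto_diff[OF tendsto_const sum_tendsto, of 1] by simp
  show "b \<longlonglongrightarrow> 0" "c \<longlonglongrightarrow> 0"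
    using invariant by (auto intro!: tendsto_sandwich[OF _ _ tendsto_const sum_tendsto] simp: less_imp_le)
qed

text \<open>
  The size of the mode \<open>b - c\<close> relative to the mode \<open>b + c\<close>. That it tends to \<open>0\<close> makes \<open>s\<close> and
  \<open>t\<close> asymptotically equal.
\<close>

definition d :: "nat \<Rightarrow> real" where "d n = (b n - c n) / (b n + c n)"

lemma d_nonneg: "d n \<ge> 0"
  using invariant[of n] by (simp add: d_def)

lemma d_Suc: "d (Suc n) = d n * (s n / (s n + 2 * t n))"
proof -
  note f = junction_facts[of n]
  have "(B n - C n) * (s n + 2 * t n) = s n * (B n + C n)" using f by (simp add: algebra_simps)
  then have "(B n - C n) / (B n + C n) = s n / (s n + 2 * t n)"
    using frac_eq_eq[of "B n + C n" "s n + 2 * t n"] nonneg[of n] f by simp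
  moreover have "d (Suc n) = d n * ((B n - C n) / (B n + C n))"
    unfolding d_def sum_step diff_step by (simp only: times_divide_times_eq)
  ultimately show ?thesis by simp
qed

text \<open>
  Because \<open>b \<ge> c\<close>, the weight \<open>t\<close> is at least \<open>q (b + c) / 2\<close>, while \<open>s \<le> b + c\<close>. So the factor
  by which \<open>d\<close> shrinks stays away from \<open>1\<close> although \<open>s\<close> and \<open>t\<close> both tend to \<open>0\<close>.
\<close>

lemma d_ratio_le: "s n / (s n + 2 * t n) \<le> 1 / (1 + q)"
proof -
  have "p * b n \<le> 1 * b n" "q * c n \<le> 1 * c n"
    by (rule mult_right_mono; use invariant[of n] p in \<open>simp add: q_def\<close>)+
  then have "s n \<le> b n + c n" unfolding s_def by linarith
  then have "q * s n \<le> q * (b n + c n)" using q_pos by (intro mult_left_mono) auto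
  also have "\<dots> \<le> 2 * t n"
  proof -
    have "q * c n \<le> q * b n" "p * c n \<ge> 0" using invariant[of n] q_pos p by (auto intro: mult_left_mono)
    then show ?thesis unfolding t_def by (simp add: algebra_simps)
  qed
  finally have "s n * (1 + q) \<le> s n + 2 * t n" by (simp add: algebra_simps)
  then have "s n \<le> 1 / (1 + q) * (s n + 2 * t n)" using q_pos by (simp add: pos_le_divide_eq)
  moreover have "s n + 2 * t n > 0" using junction_facts(1,2)[of n] by linarith
  ultimately show ?thesis by (simp only: pos_divide_le_eq)
qed

lemma d_tendsto: "d \<longlonglongrightarrow> 0"
proof -
  have "d n \<le> (1 / (1 + q)) ^ n" for n
  proof (induction n)
    case 0
    show ?case by (simp add: d_def init)
  next
    case (Suc n)
    have "d (Suc n) \<le> (1 / (1 + q)) ^ n * (1 / (1 + q))"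
      unfolding d_Suc using Suc d_nonneg[of n] d_ratio_le[of n] q_pos junction_facts[of n]
      by (intro mult_mono) auto
    then show ?case by simp
  qed
  then have le: "\<forall>\<^sub>F n in sequentially. d n \<le> (1 / (1 + q)) ^ n" by simp
  have lim: "(\<lambda>n. (1 / (1 + q)) ^ n) \<longlonglongrightarrow> 0" using q_pos by (intro LIMSEQ_realpow_zero) auto
  show ?thesis by (rule tendsto_sandwich[OF _ le tendsto_const lim]) (simp add: d_nonneg)
qed

text \<open>
  As \<open>d \<rightarrow> 0\<close>, the ratio \<open>C / B = t / (s + t)\<close> tends to \<open>1/2\<close>; as \<open>s \<rightarrow> 0\<close>, crossing a junction
  becomes overwhelmingly more likely than absorption, so \<open>A - B \<rightarrow> 0\<close>. With \<open>A + B + C = 1\<close> this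
  leaves only \<open>(2/5, 2/5, 1/5)\<close>.
\<close>

lemma junction_limits: "A \<longlonglongrightarrow> 2/5" "B \<longlonglongrightarrow> 2/5" "C \<longlonglongrightarrow> 1/5"
proof -
  define r where "r n = t n / (s n + t n)" for n
  have C_r: "C n = r n * B n" for n
  proof -
    have "s n + t n \<noteq> 0" using junction_facts(1,2)[of n] by linarith
    then have "C n = t n * B n / (s n + t n)"
      using junction_facts(4)[of n] by (simp add: nonzero_eq_divide_eq mult.commute)
    then show ?thesis by (simp add: r_def)
  qed
  have r: "r \<longlonglongrightarrow> 1/2"
  proof -
    have r_d: "r = (\<lambda>n. (1 + (q - p) / (p + q) * d n) / 2)"
    proof
      fix n
      have bc: "b n + c n \<noteq> 0" using invariant[of n] by linarith
      have pq: "p + q \<noteq> 0" using p q_pos by linarith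
      have st: "s n + t n = (p + q) * (b n + c n)" by (simp add: s_def t_def algebra_simps)
      define x where "x = (q - p) / (p + q) * d n"
      have "x * (s n + t n) = (q - p) * (b n - c n)"
        unfolding st d_def x_def using bc pq by simp
      then have "(1 + x) / 2 * (s n + t n) = (s n + t n + (q - p) * (b n - c n)) / 2"
        by (simp add: distrib_right)
      also have "\<dots> = t n" by (simp add: s_def t_def algebra_simps)
      finally have "(1 + x) / 2 * (s n + t n) = t n" .
      moreover have "s n + t n \<noteq> 0" using junction_facts(1,2)[of n] by linarith
      ultimately show "r n = (1 + (q - p) / (p + q) * d n) / 2"
        unfolding r_def x_def by (metis nonzero_divide_eq_eq)
    qed
    have "(\<lambda>n. (1 + (q - p) / (p + q) * d n) / 2) \<longlonglongrightarrow> (1 + (q - p) / (p + q) * 0) / 2"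
      by (intro tendsto_intros d_tendsto) auto
    then show ?thesis unfolding r_d by simp
  qed
  define e where "e n = s n * (1 - A n) / p" for n
  have A_e: "A n = B n + e n" for n
    using junction_facts(3)[of n] p unfolding e_def by (simp add: field_simps)
  have e: "e \<longlonglongrightarrow> 0"
  proof (rule tendsto_sandwich[OF _ _ tendsto_const])
    have "(\<lambda>n. (p * b n + q * c n) * 1 / p) \<longlonglongrightarrow> (p * 0 + q * 0) * 1 / p"
      using p by (intro tendsto_intros near_limits) auto
    then show "(\<lambda>n. s n * 1 / p) \<longlonglongrightarrow> 0" by (simp add: s_def)
    have "0 \<le> e n \<and> e n \<le> s n * 1 / p" for n
      unfolding e_def using p nonneg[of n] junction_facts[of n]
      by (intro conjI divide_nonneg_pos mult_nonneg_nonneg divide_right_mono mult_left_mono) auto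
    then show "\<forall>\<^sub>F n in sequentially. 0 \<le> e n" "\<forall>\<^sub>F n in sequentially. e n \<le> s n * 1 / p" by auto
  qed
  have B_re: "B = (\<lambda>n. (1 - e n) / (2 + r n))"
  proof
    fix n
    have "B n * (2 + r n) = 1 - e n"
      using junction_facts(5)[of n] unfolding A_e[of n] C_r[of n] by (simp add: algebra_simps)
    moreover have "r n > 0" using junction_facts[of n] by (simp add: r_def)
    ultimately show "B n = (1 - e n) / (2 + r n)" by (simp add: field_simps)
  qed
  have "(\<lambda>n. (1 - e n) / (2 + r n)) \<longlonglongrightarrow> (1 - 0) / (2 + 1/2)" by (intro tendsto_intros e r) auto
  then show B: "B \<longlonglongrightarrow> 2/5" unfolding B_re[symmetric] by simp
  have "(\<lambda>n. B n + e n) \<longlonglongrightarrow> 2/5 + 0" by (intro tendsto_intros B e)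
  then show "A \<longlonglongrightarrow> 2/5" unfolding A_e[symmetric] by simp
  have "(\<lambda>n. r n * B n) \<longlonglongrightarrow> 1/2 * (2/5)" by (intro tendsto_intros B r)
  then show "C \<longlonglongrightarrow> 1/5" unfolding C_r[symmetric] by simp
qed

end

section \<open>The limits of the hitting probabilities\<close>

text \<open>
  Index \<open>n\<close> concerns the words of length \<open>Suc (Suc n)\<close>, split by their first letter into three
  copies of the words of length \<open>Suc n\<close>; the function to which the harmonic equations are applied
  is the probability of hitting one fixed corner.
\<close>

lemma hitting_probabilities_corner_recursion:
  assumes p: "0 < p" "p < 1/2"
  shows "corner_recursion p (\<lambda>n. a_seq p (Suc n)) (\<lambda>n. b_seq p (Suc n)) (\<lambda>n. c_seq p (Suc n))
    (\<lambda>n. alpha_seq p (Suc (Suc n))) (\<lambda>n. beta_seq p (Suc (Suc n))) (\<lambda>n. gamma_seq p (Suc (Suc n)))"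
    (is "corner_recursion p ?a ?b ?c ?A ?B ?C")
proof unfold_locales
  show "0 < p" "p < 1/2" by (fact p)+
  show "?A n \<ge> 0" "?B n \<ge> 0" "?C n \<ge> 0" for n
    by (simp_all add: alpha_seq_def beta_seq_def gamma_seq_def rho_letter_def rho_nonneg)
  have "rho p [j] [i] = (if i = j then 1 else 0)" for i j
    using rho_corner[OF p, of 1 j i] by simp
  then show "?a 0 = 0" "?b 0 = 1" "?c 0 = 0"
    by (simp_all add: a_seq_def b_seq_def c_seq_def rho_letter_def)
  fix n
  define h where "h k u = rho p u (replicate (Suc (Suc n)) k)" for k u
  have harm: "harmonic p (Suc (Suc n)) (h k)" for k unfolding h_def by (rule harmonic_rho[OF p])
  have corner: "h k (j # replicate (Suc n) j) = (if k = j then 1 else 0)" for k j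
    using rho_corner[OF p, of "Suc (Suc n)" j k] by (simp add: h_def)
  have far: "h i (i # replicate (Suc n) j) = ?A n" "h j (i # replicate (Suc n) j) = ?B n"
    "h l (i # replicate (Suc n) j) = ?C n" if "distinct [i, j, l]" for i j l
    using rho_letter_far[OF p that, of "Suc n"] by (simp_all add: rho_letter_def h_def)
  have v: "h L1 (L1 # replicate (Suc n) L2) = ?A n" "h L1 (L1 # replicate (Suc n) L3) = ?A n"
    "h L1 (L2 # replicate (Suc n) L1) = ?B n" "h L1 (L3 # replicate (Suc n) L1) = ?B n"
    "h L1 (L2 # replicate (Suc n) L3) = ?C n" "h L1 (L3 # replicate (Suc n) L2) = ?C n"
    "h L2 (L1 # replicate (Suc n) L2) = ?B n" "h L2 (L1 # replicate (Suc n) L3) = ?C n"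
    "h L3 (L1 # replicate (Suc n) L2) = ?C n" "h L3 (L1 # replicate (Suc n) L3) = ?B n"
    using far[of L1 L2 L3] far[of L1 L3 L2] far[of L2 L1 L3] far[of L2 L3 L1]
      far[of L3 L1 L2] far[of L3 L2 L1] by simp_all
  note junction = harmonic_at_junction[OF p harm]
  show "?A n = p * ?B n + p * (?a n * ?A n + ?b n + ?c n * ?A n) +
      (1 - 2 * p) * (?a n * ?A n + ?b n * ?A n + ?c n)"
    using junction[of L1 L2 L3 L1] unfolding v corner by (simp add: algebra_simps)
  show "?B n = p * ?A n + p * (?a n * ?B n + ?c n * ?C n) + (1 - 2 * p) * (?a n * ?B n + ?b n * ?C n)"
    using junction[of L2 L1 L3 L1] unfolding v corner by (simp add: algebra_simps)
  show "?C n = p * ?C n + p * (?a n * ?C n + ?c n * ?B n) + (1 - 2 * p) * (?a n * ?C n + ?b n * ?B n)"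
    using junction[of L2 L3 L1 L1] unfolding v corner by (simp add: algebra_simps)
  have near: "h L1 (L1 # replicate n L1 @ [L2]) = ?a (Suc n)"
    "h L2 (L1 # replicate n L1 @ [L2]) = ?b (Suc n)"
    "h L3 (L1 # replicate n L1 @ [L2]) = ?c (Suc n)"
    by (simp_all add: h_def a_seq_def b_seq_def c_seq_def rho_letter_def)
  note near_corner = harmonic_near_corner_of_copy[OF p harm, of L1 L2 L3 _ L1]
  show "?a (Suc n) = ?a n + ?b n * ?A n + ?c n * ?A n" "?b (Suc n) = ?b n * ?B n + ?c n * ?C n"
    "?c (Suc n) = ?b n * ?C n + ?c n * ?B n"
    using near_corner[of L1] near_corner[of L2] near_corner[of L3] unfolding near v corner by simp_all
qed

theorem theorem3p1:
  fixes p :: real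
  assumes "0 < p" and "p < 1/2"
  shows "(\<lambda>n. (alpha_seq p n, beta_seq p n, gamma_seq p n)) \<longlonglongrightarrow> (2/5, 2/5, 1/5) \<and>
         (\<lambda>n. (a_seq p n, b_seq p n, c_seq p n)) \<longlonglongrightarrow> (1, 0, 0)"
proof -
  interpret corner_recursion p "\<lambda>n. a_seq p (Suc n)" "\<lambda>n. b_seq p (Suc n)" "\<lambda>n. c_seq p (Suc n)"
    "\<lambda>n. alpha_seq p (Suc (Suc n))" "\<lambda>n. beta_seq p (Suc (Suc n))" "\<lambda>n. gamma_seq p (Suc (Suc n))"
    by (rule hitting_probabilities_corner_recursion[OF assms])
  note far = junction_limits[THEN LIMSEQ_imp_Suc, THEN LIMSEQ_imp_Suc]
  note near = near_limits[THEN LIMSEQ_imp_Suc]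
  show ?thesis by (intro conjI tendsto_Pair far near)
qed

end
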